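(* Let $G$ be an infinite, residually finite group such that every proper quotient of $G$ is cyclic. Then $G\cong\mathbb{Z}$.
   Context: A proper quotient of $G$ is a quotient $G/N$ with $N$ a non-trivial normal subgroup of $G$. *)

theory Defs
  imports "HOL-Algebra.Elementary_Groups"
begin

definition residually_finite :: "('a, 'b) monoid_scheme \<Rightarrow> bool" where
  "residually_finite G \<longleftrightarrow>
     (\<forall>g \<in> carrier G. g \<noteq> \<one>\<^bsub>G\<^esub> \<longrightarrow>
        (\<exists>N. N \<lhd> G \<and> finite (carrier (G Mod N)) \<and> g \<notin> N))"

end

theory Submission
  imports Defs "HOL-Algebra.Multiplicative_Group"
begin

text \<open>
  The group is abelian: a non-trivial commutator would survive in some finite quotient; since
  \<open>G\<close> is infinite this quotient is a proper one, hence cyclic, and kills every commutator.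
  This is the only use of residual finiteness.

  In an abelian group, \<open>G/\<langle>g\<rangle>\<close> being cyclic means that \<open>G\<close> is generated by \<open>g\<close> and one further
  element \<open>c\<close>. As \<open>G\<close> is infinite, \<open>g\<close> and \<open>c\<close> cannot both have finite order, so there is an
  element of infinite order; call it \<open>g\<close> from now on. The quotient by \<open>\<langle>g\<^sup>2\<rangle>\<close> cannot be infinite
  cyclic, because it contains the element \<open>g\<close> of order two; so \<open>G/\<langle>g\<rangle>\<close> is annihilated by some
  \<open>n \<noteq> 0\<close>. Now let \<open>c\<close> generate \<open>G\<close> modulo \<open>\<langle>g\<^sup>n\<rangle>\<close>. On one hand \<open>c\<^sup>n\<close> is a power of \<open>g\<close>, on the
  other hand \<open>g\<close> is a power of \<open>c\<close> times a power of \<open>g\<close> with exponent some multiple \<open>n * j\<close>, so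
  that a power of \<open>c\<close> equals \<open>g\<close> to the exponent \<open>1 - n * j\<close>, which is prime to \<open>n\<close>. Two
  applications of Bezout's identity turn this into an element of which both \<open>c\<close> and \<open>g\<close> are
  powers. Hence \<open>G\<close> is cyclic.
\<close>

section \<open>Cyclic groups and cyclic quotients\<close>

lemma (in group) finite_range_int_pow_iff:
  assumes "x \<in> carrier G"
  shows "finite (range (\<lambda>i::int. x [^] i)) \<longleftrightarrow> ord x \<noteq> 0"
  using finite_cyclic_subgroup_order[OF assms] carrier_subgroup_generated_by_singleton[OF assms]
  by simp

lemma (in group) infinite_cyclic_group_iso_integer_group:
  assumes "cyclic_group G" "infinite (carrier G)"
  shows "G \<cong> integer_group"
proof -
  obtain x where x: "x \<in> carrier G" and car: "carrier G = range (\<lambda>i::int. x [^] i)"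
    using assms(1) cyclic_group by auto
  have "ord x = 0"
    using finite_range_int_pow_iff[OF x] car assms(2) by simp
  then have "inj (\<lambda>i::int. x [^] i)"
    by (auto simp: inj_on_def int_pow_eq[OF x])
  then have "(\<lambda>i::int. x [^] i) \<in> iso integer_group G"
    using hom_integer_group_pow[OF x] car by (simp add: iso_def bij_betw_def)
  then have "integer_group \<cong> G"
    by (auto simp: is_iso_def)
  then show ?thesis
    by (rule group.iso_sym[OF group_integer_group])
qed

lemma (in normal) cyclic_FactGroup_imp_generator:
  assumes "cyclic_group (G Mod H)"
  shows "\<exists>c\<in>carrier G. \<forall>x\<in>carrier G. \<exists>(i::int). \<exists>y\<in>H. x = y \<otimes> c [^] i"
proof -
  interpret Q: group "G Mod H"
    by (rule factorgroup_is_group)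
  obtain X where X_in: "X \<in> carrier (G Mod H)"
    and gen: "carrier (G Mod H) = range (\<lambda>i::int. X [^]\<^bsub>G Mod H\<^esub> i)"
    using assms Q.cyclic_group by auto
  obtain c where c: "c \<in> carrier G" and X: "X = H #> c"
    using X_in unfolding carrier_FactGroup by blast
  have "\<exists>(i::int). \<exists>y\<in>H. x = y \<otimes> c [^] i" if x: "x \<in> carrier G" for x
  proof -
    have "H #> x \<in> carrier (G Mod H)"
      using x by (auto simp: carrier_FactGroup)
    then obtain i :: int where "H #> x = H #> (c [^] i)"
      using gen FactGroup_int_pow[OF c] X by auto
    then have "x \<in> H #> (c [^] i)"
      using rcos_self[OF x] subgroup_axioms by auto
    then show ?thesis
      by (auto simp: r_coset_def)
  qed
  then show ?thesis
    using c by blast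
qed

lemma (in comm_group) cyclic_quotient_by_powers:
  assumes g: "g \<in> carrier G"
    and cyc: "cyclic_group (G Mod range (\<lambda>i::int. g [^] i))"
  obtains c where "c \<in> carrier G"
    and "\<And>x. x \<in> carrier G \<Longrightarrow> \<exists>(i::int) (j::int). x = c [^] i \<otimes> g [^] j"
proof -
  interpret N: normal "range (\<lambda>i::int. g [^] i)" G
    by (rule subgroup_imp_normal[OF subgroup_of_powers[OF g]])
  obtain c where c: "c \<in> carrier G"
    and gen: "\<forall>x\<in>carrier G. \<exists>(i::int). \<exists>y\<in>range (\<lambda>i::int. g [^] i). x = y \<otimes> c [^] i"
    using N.cyclic_FactGroup_imp_generator[OF cyc] by auto
  have "\<exists>(i::int) (j::int). x = c [^] i \<otimes> g [^] j" if "x \<in> carrier G" for x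
    using gen that m_comm[OF int_pow_closed[OF c] int_pow_closed[OF g]] by fastforce
  with c show ?thesis
    by (rule that)
qed

section \<open>Abelian groups with cyclic proper quotients\<close>

text \<open>
  If \<open>g\<close> and an element generating \<open>G\<close> modulo \<open>\<langle>g\<rangle>\<close> both had finite order, then \<open>G\<close>, whose
  elements are products of a power of one and a power of the other, would be finite.
\<close>

lemma (in comm_group) exists_infinite_order:
  assumes inf: "infinite (carrier G)"
    and g: "g \<in> carrier G"
    and cyc: "cyclic_group (G Mod range (\<lambda>i::int. g [^] i))"
  shows "\<exists>x\<in>carrier G. ord x = 0"
proof (rule ccontr)
  assume "\<not> ?thesis"
  then have fin: "finite (range (\<lambda>i::int. x [^] i))" if "x \<in> carrier G" for x
    using finite_range_int_pow_iff that by blast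
  obtain c where c: "c \<in> carrier G"
    and gen: "\<And>x. x \<in> carrier G \<Longrightarrow> \<exists>(i::int) (j::int). x = c [^] i \<otimes> g [^] j"
    using cyclic_quotient_by_powers[OF g cyc] by blast
  have "carrier G \<subseteq> (\<lambda>(a, b). a \<otimes> b) ` (range (\<lambda>i::int. c [^] i) \<times> range (\<lambda>i::int. g [^] i))"
    using gen by fastforce
  then have "finite (carrier G)"
    using fin[OF c] fin[OF g] by (meson finite_SigmaI finite_imageI finite_subset)
  with inf show False by contradiction
qed

text \<open>
  With \<open>u * d + v * e = 1\<close>, the common root is \<open>g\<close> to the \<open>u\<close> times \<open>c\<close> to the \<open>v\<close>: a root
  \<open>h\<close> with \<open>g = h\<^sup>d\<close> and \<open>c = h\<^sup>e\<close> equals \<open>h\<close> to the \<open>u * d + v * e\<close>, so no other choice is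
  possible.
\<close>

lemma (in comm_group) common_root_of_coprime_powers:
  fixes d e :: int
  assumes g: "g \<in> carrier G" and c: "c \<in> carrier G"
    and eq: "c [^] d = g [^] e" and cop: "coprime d e"
  obtains h where "h \<in> carrier G" "g = h [^] d" "c = h [^] e"
proof -
  obtain u v where uv: "u * d + v * e = 1"
    using cop bezout_int[of d e] by auto
  define h where "h = g [^] u \<otimes> c [^] v"
  have h_pow: "h [^] k = g [^] (u * k) \<otimes> c [^] (v * k)" for k :: int
    by (simp add: h_def g c int_pow_distrib int_pow_pow)
  have "c [^] (v * d) = (c [^] d) [^] v"
    by (simp add: c int_pow_pow mult.commute)
  then have "h [^] d = g [^] (u * d + v * e)"
    by (simp add: h_pow eq g int_pow_pow int_pow_mult mult.commute)
  then have "g = h [^] d"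
    using uv g by simp
  moreover have "g [^] (u * e) = (g [^] e) [^] u"
    by (simp add: g int_pow_pow mult.commute)
  then have "h [^] e = c [^] (u * d + v * e)"
    by (simp add: h_pow c int_pow_pow int_pow_mult mult.commute flip: eq)
  then have "c = h [^] e"
    using uv c by simp
  moreover have "h \<in> carrier G"
    using g c by (simp add: h_def)
  ultimately show ?thesis
    using that by blast
qed

text \<open>
  If \<open>G/\<langle>g\<^sup>2\<rangle>\<close> is cyclic with generator \<open>c\<close>, then \<open>g\<close> equals some power \<open>k\<close> of \<open>c\<close> up to an even
  power of \<open>g\<close>. So \<open>c\<close> to the \<open>k\<close> is an odd power of \<open>g\<close>, and in particular \<open>k \<noteq> 0\<close>: no odd
  power of an element of infinite order is trivial. Since \<open>c\<close> and \<open>g\<close> generate \<open>G\<close>, the same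
  \<open>k\<close> sends every element into \<open>\<langle>g\<rangle>\<close>.
\<close>

lemma (in comm_group) quotient_by_powers_has_exponent:
  assumes g: "g \<in> carrier G" and ord_g: "ord g = 0"
    and cyc: "cyclic_group (G Mod range (\<lambda>i::int. (g [^] (2::int)) [^] i))"
  obtains n :: int where "n \<noteq> 0"
    and "\<And>x. x \<in> carrier G \<Longrightarrow> \<exists>(j::int). x [^] n = g [^] j"
proof -
  obtain c where c: "c \<in> carrier G"
    and "\<And>x. x \<in> carrier G \<Longrightarrow> \<exists>(i::int) (j::int). x = c [^] i \<otimes> (g [^] (2::int)) [^] j"
    using cyclic_quotient_by_powers[OF int_pow_closed[OF g] cyc] by blast
  then have gen: "\<exists>(i::int) (j::int). x = c [^] i \<otimes> g [^] (2 * j)" if "x \<in> carrier G" for x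
    using that by (simp add: int_pow_pow g)
  obtain k j :: int where kj: "g = c [^] k \<otimes> g [^] (2 * j)"
    using gen[OF g] by blast
  then have ck: "c [^] k = g [^] (1 - 2 * j)"
    by (metis c g int_pow_1 int_pow_closed int_pow_diff inv_solve_right)
  have "k \<noteq> 0"
  proof
    assume "k = 0"
    then have "g [^] (1 - 2 * j) = \<one>"
      using ck by simp
    then have "1 - 2 * j = 0"
      using int_pow_eq_id[OF g] ord_g by simp
    then show False by presburger
  qed
  moreover have "\<exists>(l::int). x [^] k = g [^] l" if x_in: "x \<in> carrier G" for x
  proof -
    obtain i l :: int where x: "x = c [^] i \<otimes> g [^] (2 * l)"
      using gen[OF x_in] by blast
    have "x [^] k = (c [^] k) [^] i \<otimes> g [^] (2 * l * k)"
      by (simp add: x c g int_pow_distrib int_pow_pow mult.commute)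
    also have "\<dots> = g [^] ((1 - 2 * j) * i + 2 * l * k)"
      by (simp add: ck g int_pow_pow int_pow_mult)
    finally show ?thesis by blast
  qed
  ultimately show ?thesis
    by (rule that)
qed

text \<open>
  Let \<open>n\<close> be an exponent of \<open>G/\<langle>g\<rangle>\<close>, let \<open>c\<close> generate \<open>G\<close> modulo \<open>\<langle>g\<^sup>n\<rangle>\<close>, and write \<open>g\<close> as \<open>c\<close> to
  the \<open>k\<close> times \<open>g\<close> to the \<open>n * j\<close>. For \<open>d = gcd n k\<close> Bezout gives an exponent \<open>e\<close> with
  \<open>c\<^sup>d = g\<^sup>e\<close>. Comparing exponents of \<open>g\<close>, \<open>e\<close> divides \<open>1 - n * j\<close> while \<open>d\<close> divides \<open>n\<close>, so
  \<open>d\<close> and \<open>e\<close> are coprime and \<open>c\<close>, \<open>g\<close> are powers of a common element.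
\<close>

lemma (in comm_group) cyclic_if_cyclic_quotients_by_powers:
  assumes g: "g \<in> carrier G" and ord_g: "ord g = 0"
    and cyc: "\<And>m::int. m \<noteq> 0 \<Longrightarrow> cyclic_group (G Mod range (\<lambda>i::int. (g [^] m) [^] i))"
  shows "cyclic_group G"
proof -
  have "cyclic_group (G Mod range (\<lambda>i::int. (g [^] (2::int)) [^] i))"
    by (rule cyc) simp
  then obtain n :: int where "n \<noteq> 0"
    and ex: "\<And>x. x \<in> carrier G \<Longrightarrow> \<exists>(j::int). x [^] n = g [^] j"
    using quotient_by_powers_has_exponent[OF g ord_g] by blast
  obtain c where c: "c \<in> carrier G"
    and "\<And>x. x \<in> carrier G \<Longrightarrow> \<exists>(i::int) (j::int). x = c [^] i \<otimes> (g [^] n) [^] j"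
    using cyclic_quotient_by_powers[OF int_pow_closed[OF g] cyc[OF \<open>n \<noteq> 0\<close>]] by blast
  then have gen: "\<exists>(i::int) (j::int). x = c [^] i \<otimes> g [^] (n * j)" if "x \<in> carrier G" for x
    using that by (simp add: int_pow_pow g)
  obtain s :: int where cn: "c [^] n = g [^] s"
    using ex[OF c] by blast
  obtain k j :: int where "g = c [^] k \<otimes> g [^] (n * j)"
    using gen[OF g] by blast
  then have ck: "c [^] k = g [^] (1 - n * j)"
    by (metis c g int_pow_1 int_pow_closed int_pow_diff inv_solve_right)
  define d where "d = gcd n k"
  obtain a b where ab: "a * n + b * k = d"
    using bezout_int[of n k] by (auto simp: d_def)
  obtain n' k' where n': "n = d * n'" and k': "k = d * k'"
    unfolding d_def by (metis dvdE gcd_dvd1 gcd_dvd2)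
  define e where "e = s * a + (1 - n * j) * b"
  have "c [^] d = (c [^] n) [^] a \<otimes> (c [^] k) [^] b"
    by (simp add: c int_pow_pow int_pow_mult mult.commute flip: ab)
  also have "\<dots> = g [^] e"
    by (simp add: cn ck g int_pow_pow int_pow_mult e_def)
  finally have cd: "c [^] d = g [^] e" .
  have "g [^] (e * k') = g [^] (1 - n * j)"
    using cd ck by (simp add: k' c g flip: int_pow_pow)
  then have "e * k' = 1 - n * j"
    using int_pow_eq[OF g] ord_g by simp
  then have "e * k' + d * (n' * j) = 1"
    by (simp add: n')
  then have "coprime d e"
    by (intro coprimeI) (metis dvd_add dvd_mult2)
  then obtain h where h: "h \<in> carrier G" and gh: "g = h [^] d" and ch: "c = h [^] e"
    using common_root_of_coprime_powers[OF g c cd] by blast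
  have "x \<in> range (\<lambda>i::int. h [^] i)" if x: "x \<in> carrier G" for x
  proof -
    obtain i l :: int where "x = c [^] i \<otimes> g [^] (n * l)"
      using gen[OF x] by blast
    then have "x = h [^] (e * i + d * (n * l))"
      by (simp add: gh ch h int_pow_pow int_pow_mult)
    then show ?thesis by blast
  qed
  then have "carrier G = range (\<lambda>i::int. h [^] i)"
    using h by auto
  then show ?thesis
    using h cyclic_group by blast
qed

text \<open>
  Every non-trivial element generates a non-trivial normal subgroup, so the hypothesis on proper
  quotients yields an element of infinite order and then applies to all its non-zero powers.
\<close>

lemma (in comm_group) infinite_cyclic_proper_quotients_imp_cyclic:
  assumes inf: "infinite (carrier G)"
    and quot: "\<And>N. N \<lhd> G \<Longrightarrow> N \<noteq> {\<one>} \<Longrightarrow> cyclic_group (G Mod N)"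
  shows "cyclic_group G"
proof -
  have cyc: "cyclic_group (G Mod range (\<lambda>i::int. x [^] i))" if x: "x \<in> carrier G" "x \<noteq> \<one>" for x
  proof (rule quot)
    show "range (\<lambda>i::int. x [^] i) \<lhd> G"
      by (rule subgroup_imp_normal[OF subgroup_of_powers[OF x(1)]])
    have "x \<in> range (\<lambda>i::int. x [^] i)"
      using int_pow_1[OF x(1)] by (metis rangeI)
    with x(2) show "range (\<lambda>i::int. x [^] i) \<noteq> {\<one>}"
      by blast
  qed
  have "\<not> carrier G \<subseteq> {\<one>}"
    using inf finite_subset by blast
  then obtain x where "x \<in> carrier G" "x \<noteq> \<one>"
    by blast
  then obtain g where g: "g \<in> carrier G" "ord g = 0"
    using exists_infinite_order[OF inf] cyc by blast
  show ?thesis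
  proof (rule cyclic_if_cyclic_quotients_by_powers[OF g])
    fix m :: int assume "m \<noteq> 0"
    then have "g [^] m \<noteq> \<one>"
      using int_pow_eq_id[OF g(1)] g(2) by simp
    then show "cyclic_group (G Mod range (\<lambda>i::int. (g [^] m) [^] i))"
      by (rule cyc[OF int_pow_closed[OF g(1)]])
  qed
qed

section \<open>Residually finite groups\<close>

lemma (in group) infinite_quotient_by_trivial_subgroup:
  assumes "infinite (carrier G)"
  shows "infinite (carrier (G Mod {\<one>}))"
proof -
  have "inj_on (\<lambda>x. {\<one>} #> x) (carrier G)"
    by (rule inj_onI) (simp add: r_coset_def)
  then have "infinite ((\<lambda>x. {\<one>} #> x) ` carrier G)"
    using assms finite_imageD by blast
  then show ?thesis
    by (simp only: carrier_FactGroup not_False_eq_True)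
qed

text \<open>
  If all finite quotients are abelian, the derived subgroup lies in every normal subgroup of finite
  index, and these intersect trivially in a residually finite group.
\<close>

lemma (in group) residually_finite_imp_comm_group:
  assumes rf: "residually_finite G"
    and ab: "\<And>N. N \<lhd> G \<Longrightarrow> finite (carrier (G Mod N)) \<Longrightarrow> comm_group (G Mod N)"
  shows "comm_group G"
proof (rule group_comm_groupI)
  fix x y assume x: "x \<in> carrier G" and y: "y \<in> carrier G"
  define z where "z = x \<otimes> y \<otimes> inv x \<otimes> inv y"
  have z_derived: "z \<in> derived G (carrier G)"
    unfolding derived_def z_def using x y by (blast intro: generate.incl)
  have "z = \<one>"
  proof (rule ccontr)
    assume "z \<noteq> \<one>"
    moreover have "z \<in> carrier G"
      using x y by (simp add: z_def)
    ultimately obtain N where N: "N \<lhd> G" "finite (carrier (G Mod N))" and "z \<notin> N"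
      using rf unfolding residually_finite_def by blast
    then show False
      using derived_minimal[OF N(1) ab[OF N]] z_derived by blast
  qed
  moreover have "z = (x \<otimes> y) \<otimes> inv (y \<otimes> x)"
    using x y by (simp add: z_def inv_mult_group m_assoc)
  ultimately have "\<one> = (x \<otimes> y) \<otimes> inv (y \<otimes> x)"
    by simp
  then show "x \<otimes> y = y \<otimes> x"
    using x y inv_solve_right[of \<one> "x \<otimes> y" "y \<otimes> x"] by simp
qed

theorem lemma1p1:
  fixes G :: "('a, 'b) monoid_scheme"
  assumes "group G"
    and "infinite (carrier G)"
    and "residually_finite G"
    and "\<And>N. N \<lhd> G \<Longrightarrow> N \<noteq> {\<one>\<^bsub>G\<^esub>} \<Longrightarrow> cyclic_group (G Mod N)"
  shows "G \<cong> integer_group"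
proof -
  interpret group G by fact
  have "comm_group (G Mod N)" if N: "N \<lhd> G" and fin: "finite (carrier (G Mod N))" for N
  proof -
    have "N \<noteq> {\<one>\<^bsub>G\<^esub>}"
      using fin infinite_quotient_by_trivial_subgroup[OF assms(2)] by auto
    then show ?thesis
      by (rule group.cyclic_imp_abelian_group[OF normal.factorgroup_is_group[OF N] assms(4)[OF N]])
  qed
  then interpret comm_group G
    by (rule residually_finite_imp_comm_group[OF assms(3)])
  have "cyclic_group G"
    by (rule infinite_cyclic_proper_quotients_imp_cyclic[OF assms(2,4)])
  then show ?thesis
    by (rule infinite_cyclic_group_iso_integer_group[OF _ assms(2)])
qed

end
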